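(* Let $G$ be a finite $p$-group for some prime $p$, and let $N < M$ be normal subgroups of $G$ (with $N$ properly contained in $M$) with $g \in M \setminus N$ such that $g^G = M \setminus N$. Then $p = 2$ and $|M:N| = 2$.
   Context: All groups are finite. $g^G$ denotes the conjugacy class of $g$ in $G$. *)

theory Defs
  imports "HOL-Algebra.Group_Action" "HOL-Computational_Algebra.Primes"
begin

definition finite_p_group :: "nat \<Rightarrow> ('a, 'b) monoid_scheme \<Rightarrow> bool"
  where "finite_p_group p G \<longleftrightarrow> group G \<and> finite (carrier G) \<and> (\<exists>n::nat. order G = p ^ n)"

(* The orbit under the conjugation action in the form of group.action_by_conjugation.
   Conjugating by h or by its inverse gives the same class. *)
definition conj_class :: "('a, 'b) monoid_scheme \<Rightarrow> 'a \<Rightarrow> 'a set"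
  where "conj_class G g =
    orbit G (\<lambda>h. \<lambda>x \<in> carrier G. h \<otimes>\<^bsub>G\<^esub> x \<otimes>\<^bsub>G\<^esub> (inv\<^bsub>G\<^esub> h)) g"

(* The index |M : N|; intended for subgroups N \<subseteq> M of G. *)
definition subgroup_index :: "('a, 'b) monoid_scheme \<Rightarrow> 'a set \<Rightarrow> 'a set \<Rightarrow> nat"
  where "subgroup_index G M N = card (rcosets\<^bsub>G\<lparr>carrier := M\<rparr>\<^esub> N)"

end

theory Submission
  imports Defs
begin

text \<open>
  The argument only counts. By orbit-stabilizer, a conjugacy class of a finite \<open>p\<close>-group
  has \<open>p\<close>-power size (\<open>card_conj_class_dvd_order\<close>). Writing \<open>k\<close> for the index of \<open>N\<close> in \<open>M\<close>, the
  set \<open>M - N\<close> consists of \<open>k - 1\<close> cosets of \<open>N\<close>. Hence, if it is a conjugacy class, the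
  consecutive numbers \<open>k - 1\<close> and \<open>k\<close> both divide a power of \<open>p\<close>. As \<open>N\<close> is proper in \<open>M\<close>,
  \<open>k\<close> is not \<open>1\<close> and so is divisible by \<open>p\<close>; then \<open>k - 1\<close> is not, which forces \<open>k - 1 = 1\<close> and
  \<open>p = k = 2\<close> (\<open>consecutive_divisors_of_prime_power\<close>).
\<close>

lemma consecutive_divisors_of_prime_power:
  fixes p k n :: nat
  assumes "prime p" and "k dvd p ^ n" and "k - 1 dvd p ^ n" and "k \<noteq> 1"
  shows "p = 2 \<and> k = 2"
proof -
  obtain a where a: "k = p ^ a"
    using assms(1,2) divides_primepow_nat by blast
  obtain b where b: "k - 1 = p ^ b"
    using assms(1,3) divides_primepow_nat by blast
  have "a \<noteq> 0"
    using a \<open>k \<noteq> 1\<close> by (intro notI) simp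
  then have "p dvd k"
    using a by (simp add: dvd_power)
  have "k > 0"
    using a prime_gt_0_nat[OF \<open>prime p\<close>] by simp
  have "b = 0"
  proof (rule ccontr)
    assume "b \<noteq> 0"
    then have "p dvd k - 1"
      using b by (simp add: dvd_power)
    then have "p dvd k - (k - 1)"
      using \<open>p dvd k\<close> by (rule dvd_diff_nat[rotated])
    then show False
      using \<open>k > 0\<close> \<open>prime p\<close> by simp
  qed
  then have "k = 2"
    using b by simp
  moreover have "p = 2"
    using \<open>k = 2\<close> \<open>p dvd k\<close> \<open>prime p\<close> primes_dvd_imp_eq two_is_prime_nat by blast
  ultimately show ?thesis
    by simp
qed

lemma card_conj_class_dvd_order:
  assumes "group G" and "g \<in> carrier G"
  shows "card (conj_class G g) dvd order G"
proof -
  let ?\<phi> = "\<lambda>h. \<lambda>x \<in> carrier G. h \<otimes>\<^bsub>G\<^esub> x \<otimes>\<^bsub>G\<^esub> (inv\<^bsub>G\<^esub> h)"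
  have "group_action G (carrier G) ?\<phi>"
    using assms(1) by (rule group.action_by_conjugation)
  then have "order G = card (orbit G ?\<phi> g) * card (stabilizer G ?\<phi> g)"
    using assms(2) by (rule group_action.orbit_stabilizer_theorem[symmetric])
  then show ?thesis
    unfolding conj_class_def by (rule dvdI)
qed

lemma card_eq_subgroup_index_mult_card:
  assumes "group G" and "subgroup M G" and "subgroup N G" and "N \<subseteq> M"
  shows "card M = subgroup_index G M N * card N"
proof -
  have "group (G\<lparr>carrier := M\<rparr>)"
    using assms(2,1) by (rule subgroup.subgroup_is_group)
  moreover have "subgroup N (G\<lparr>carrier := M\<rparr>)"
    using group.subgroup_incl[OF assms(1) assms(3) assms(2) assms(4)] .
  ultimately have "subgroup_index G M N * card N = order (G\<lparr>carrier := M\<rparr>)"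
    unfolding subgroup_index_def by (rule group.lagrange)
  then show ?thesis
    by (simp add: order_def)
qed

theorem theorem3:
  fixes G :: "('a, 'b) monoid_scheme" and p :: nat and M N :: "'a set" and g :: 'a
  assumes "prime p" and "finite_p_group p G"
    and "N \<lhd> G" and "M \<lhd> G" and "N \<subset> M"
    and "g \<in> M - N"
    and "conj_class G g = M - N"
  shows "p = 2 \<and> subgroup_index G M N = 2"
proof -
  obtain n where G: "group G" "finite (carrier G)" and order: "order G = p ^ n"
    using assms(2) unfolding finite_p_group_def by blast
  have M: "subgroup M G" and N: "subgroup N G"
    using assms(3,4) by (simp_all add: normal_imp_subgroup)
  have "finite M"
    using subgroup.subset[OF M] G(2) finite_subset by blast
  define k where "k = subgroup_index G M N"
  have card_M: "card M = k * card N"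
    unfolding k_def using G(1) M N assms(5)
    by (intro card_eq_subgroup_index_mult_card) auto
  have "card M dvd p ^ n"
    using group.lagrange[OF G(1) M] order by (metis dvd_triv_right)
  then have "k dvd p ^ n"
    using card_M by (metis dvd_mult_left)
  moreover have "k - 1 dvd p ^ n"
  proof -
    have "finite N" and "N \<subseteq> M"
      using assms(5) \<open>finite M\<close> by (auto intro: finite_subset)
    then have "card (M - N) = (k - 1) * card N"
      using card_M by (simp add: card_Diff_subset diff_mult_distrib)
    moreover have "card (M - N) dvd p ^ n"
      using card_conj_class_dvd_order[OF G(1), of g] assms(6,7) subgroup.subset[OF M] order
      by auto
    ultimately show ?thesis
      by (metis dvd_mult_left)
  qed
  moreover have "k \<noteq> 1"
    using card_M psubset_card_mono[OF \<open>finite M\<close> assms(5)] by auto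
  ultimately show ?thesis
    using consecutive_divisors_of_prime_power[OF assms(1)] unfolding k_def by blast
qed

end
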